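(* Let $m\ge 2$ be an integer, let $d>0$, and consider the star search problem on $m$ rays with turn cost $d$. The search strategy $$x_i=\frac d2\left(\left(\frac{m}{m-1}\right)^{i}-1\right),\qquad i=1,2,3,\ldots,$$ finds every target at cost at most $$\left(1+2\frac{m^m}{(m-1)^{m-1}}\right)\mathrm{OPT}+m\left(\left(\frac{m}{m-1}\right)^{m-1}-1\right)d,$$ where $\mathrm{OPT}>0$ is the distance of the target from the origin. This strategy is optimal: if $B$ is a real number and $(x_i)_{i\ge1}$ is any search strategy that finds every target (on every ray, at every distance $\mathrm{OPT}>0$) at cost at most $\left(1+2\frac{m^m}{(m-1)^{m-1}}\right)\mathrm{OPT}+B$, then $B\ge m\left(\left(\frac{m}{m-1}\right)^{m-1}-1\right)d$.
   Context: Star search problem on $m$ rays with turn cost: an immobile target is hidden on one of $m$ rays emanating from a common origin, at an unknown distance $\mathrm{OPT}>0$ from the origin. The searcher starts at the origin and notices the target only when she reaches its position. A search strategy is a sequence $x_1,x_2,x_3,\ldots$ of positive reals with $x_{i+m}>x_i$ for all $i$, where the rays are visited cyclically: in step $i$ the searcher goes from the origin out to distance $x_i$ on ray number $i \bmod m$, turns, and comes back to the origin. Each such out-and-back step without finding the target incurs turn cost $d=d_1+d_2$ (a cost $d_1$ for turning on the ray and a cost $d_2$ for turning at the origin), in addition to the distance traveled. Explicitly, for a target at distance $t>0$ on a given ray, let $k$ be the least index such that step $k$ is on that ray and $x_k\ge t$; the cost is $2\sum_{i=1}^{k-1}x_i+(k-1)d+t$ (and $+\infty$ if no such $k$ exists).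 The number $1+2\frac{m^m}{(m-1)^{m-1}}$ is the optimal (smallest possible) competitive ratio of the star search problem without turn cost. *)

theory Defs
  imports Complex_Main "HOL-Library.Extended_Real"
begin

text \<open>
  A sequence \<open>x\<close> is used from index 1 on; the value \<open>x 0\<close> is junk and is never constrained or read.
  The \<open>m\<close> rays are numbered \<open>0, \<dots>, m - 1\<close>, and step \<open>i \<ge> 1\<close> goes to distance \<open>x i\<close>
  on ray \<open>i mod m\<close>.
\<close>

definition search_strategy :: "nat \<Rightarrow> (nat \<Rightarrow> real) \<Rightarrow> bool" where
  "search_strategy m x \<longleftrightarrow> (\<forall>i\<ge>1. x i > 0 \<and> x (i + m) > x i)"

definition finds_at :: "nat \<Rightarrow> (nat \<Rightarrow> real) \<Rightarrow> nat \<Rightarrow> real \<Rightarrow> nat \<Rightarrow> bool" where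
  "finds_at m x r t k \<longleftrightarrow> k \<ge> 1 \<and> k mod m = r \<and> x k \<ge> t"

text \<open>
  The turn cost \<open>d\<close> is the total \<open>d\<^sub>1 + d\<^sub>2\<close> of the turn on the ray and the turn at the origin;
  it is charged for the \<open>k - 1\<close> unsuccessful steps only.
\<close>

definition search_cost :: "nat \<Rightarrow> real \<Rightarrow> (nat \<Rightarrow> real) \<Rightarrow> nat \<Rightarrow> real \<Rightarrow> ereal" where
  "search_cost m d x r t =
     (if \<exists>k. finds_at m x r t k
      then let k = (LEAST k. finds_at m x r t k)
           in ereal (2 * (\<Sum>i=1..<k. x i) + (real k - 1) * d + t)
      else \<infinity>)"

definition finds_all_within :: "nat \<Rightarrow> real \<Rightarrow> (nat \<Rightarrow> real) \<Rightarrow> real \<Rightarrow> real \<Rightarrow> bool" where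
  "finds_all_within m d x c B \<longleftrightarrow>
     (\<forall>r<m. \<forall>t>0. search_cost m d x r t \<le> ereal (c * t + B))"

end

theory Submission
  imports Defs
begin

text \<open>
  Put \<open>q = m / (m - 1)\<close> and \<open>K = m\<^sup>m / (m - 1)\<^bsup>m - 1\<^esup>\<close>, so that \<open>(m - 1) q\<^sup>m = K\<close>. For the upper bound the
  cost is a geometric sum, and leastness of the finding step \<open>k\<close> gives \<open>x\<^bsub>k - m\<^esub> < t\<close>.

  For the lower bound, a target just beyond \<open>x\<^sub>k\<close> (just beyond the origin if \<open>k = 0\<close>) is found no
  earlier than at step \<open>k + m\<close>. If \<open>B\<close> were smaller than claimed, suitably shifted partial sums
  \<open>T\<^sub>k\<close> of \<open>x\<^sub>i + d / 2\<close> would satisfy \<open>T\<^bsub>k + m\<^esub> \<le> K (T\<^bsub>k + 1\<^esub> - T\<^sub>k)\<close> and \<open>T\<^sub>1 / T\<^sub>0 < q\<close>. But the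
  infimum \<open>I\<close> of the ratios \<open>T\<^bsub>k + 1\<^esub> / T\<^sub>k\<close> must satisfy \<open>I\<^sup>m - K I + K \<le> 0\<close>, and the left side is
  a convex function of \<open>I\<close> with the double root \<open>q\<close>, so \<open>I = q\<close>.
\<close>

section \<open>The extremal polynomial and growth under the recurrence\<close>

lemma Bernoulli_inequality_strict:
  fixes u :: real
  assumes "n \<ge> 2" "u \<ge> -1" "u \<noteq> 0"
  shows "1 + real n * u < (1 + u) ^ n"
proof -
  obtain k where k: "n = Suc k" "k > 0"
    using assms(1) by (cases n) auto
  have "1 + real n * u < 1 + real n * u + real k * u\<^sup>2"
    using assms k by simp
  also have "\<dots> = (1 + u) * (1 + real k * u)"
    by (simp add: k algebra_simps power2_eq_square)
  also have "\<dots> \<le> (1 + u) * (1 + u) ^ k"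
    using assms by (intro mult_left_mono Bernoulli_inequality) auto
  finally show ?thesis by (simp add: k)
qed

lemma star_constant_eq:
  assumes "m \<ge> 2"
  shows "real m ^ m / (real m - 1) ^ (m - 1) = (real m - 1) * (real m / (real m - 1)) ^ m"
    and "real m ^ m / (real m - 1) ^ (m - 1) = real m * (real m / (real m - 1)) ^ (m - 1)"
proof -
  obtain k where "m = Suc k" "k > 0"
    using assms by (cases m) auto
  then show "real m ^ m / (real m - 1) ^ (m - 1) = (real m - 1) * (real m / (real m - 1)) ^ m"
    and "real m ^ m / (real m - 1) ^ (m - 1) = real m * (real m / (real m - 1)) ^ (m - 1)"
    by (simp_all add: field_simps)
qed

text \<open>Since \<open>K = (real m - 1) * q ^ m\<close>, division by \<open>q ^ m\<close> turns
  the claim into strict Bernoulli with \<open>u = y / q - 1\<close>: the line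
  \<open>K * y - K\<close> is the tangent of \<open>y ^ m\<close> at \<open>q\<close>.\<close>

lemma star_polynomial_pos:
  fixes y :: real
  assumes "m \<ge> 2" "y \<ge> 0" "y \<noteq> real m / (real m - 1)"
  defines "K \<equiv> real m ^ m / (real m - 1) ^ (m - 1)"
  shows "y ^ m - K * y + K > 0"
proof -
  define q where "q = real m / (real m - 1)"
  have q: "q > 0" "y \<noteq> q" and mq: "real m = (real m - 1) * q"
    using assms by (auto simp: q_def)
  have Kq: "K = (real m - 1) * q ^ m"
    unfolding K_def q_def using star_constant_eq(1)[OF assms(1)] .
  have "1 + real m * (y / q - 1) < (1 + (y / q - 1)) ^ m"
    using assms q by (intro Bernoulli_inequality_strict) auto
  then have "q ^ m * (1 + real m * (y / q - 1)) < q ^ m * (y / q) ^ m"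
    using q by simp
  also have "q ^ m * (y / q) ^ m = y ^ m"
    using q by (simp add: power_divide)
  also have "1 + real m * (y / q - 1) = (real m - 1) * (y - 1)"
  proof -
    have "real m * (y / q) = (real m - 1) * y"
      using q by (subst mq) simp
    then show ?thesis by (simp add: algebra_simps)
  qed
  finally show ?thesis
    by (simp add: Kq algebra_simps)
qed

lemma ratio_ge_of_recurrence:
  fixes T :: "nat \<Rightarrow> real"
  assumes "m \<ge> 2"
    and pos: "\<And>k. T k > 0" and mono: "\<And>k. T k \<le> T (Suc k)"
  defines "K \<equiv> real m ^ m / (real m - 1) ^ (m - 1)"
  assumes rec: "\<And>k. T (k + m) \<le> K * (T (Suc k) - T k)"
  shows "real m / (real m - 1) * T 0 \<le> T 1"
proof (rule ccontr)
  assume contra: "\<not> ?thesis"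
  define r where "r k = T (Suc k) / T k" for k
  define I where "I = (INF k. r k)"
  have r1: "r k \<ge> 1" for k
    using pos[of k] mono[of k] by (simp add: r_def)
  then have bdd: "bdd_below (range r)"
    by (intro bdd_belowI[of _ 1]) auto
  have I1: "I \<ge> 1"
    unfolding I_def using r1 by (intro cINF_greatest) auto
  have I_le: "I \<le> r k" for k
    unfolding I_def using bdd by (intro cINF_lower) auto
  have growth: "I ^ n * T k \<le> T (k + n)" for n k
  proof (induction n)
    case (Suc n)
    have "I ^ Suc n * T k = I * (I ^ n * T k)" by simp
    also have "\<dots> \<le> r (k + n) * T (k + n)"
      using Suc I_le[of "k + n"] I1 pos[of k] by (intro mult_mono) (auto intro: order_trans[of 0 1])
    also have "\<dots> = T (k + Suc n)"
      using pos[of "k + n"] by (simp add: r_def)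
    finally show ?case .
  qed simp
  have K_pos: "K > 0"
    unfolding K_def using assms(1) by simp
  \<comment> \<open>Only \<open>m - 1\<close> steps of growth are used, from \<open>Suc k\<close> to
    \<open>k + m\<close>, so that \<open>r k\<close> survives and the bound can pass to the
    infimum.\<close>
  have step: "K \<le> (K - I ^ (m - 1)) * r k" for k
  proof -
    have "I ^ (m - 1) * T (Suc k) \<le> T (Suc k + (m - 1))"
      by (rule growth)
    also have "\<dots> = T (k + m)"
      using assms(1) by simp
    also note rec
    finally have "K * T k \<le> (K - I ^ (m - 1)) * T (Suc k)"
      by (simp add: algebra_simps)
    then show ?thesis
      using pos[of k] by (simp add: r_def field_simps)
  qed
  have w: "K - I ^ (m - 1) > 0"
    using step[of 0] K_pos r1[of 0]
    by (metis less_le_trans linorder_not_less mult_nonpos_nonneg order_trans zero_le_one)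
  have "K / (K - I ^ (m - 1)) \<le> I"
    unfolding I_def using step w
    by (intro cINF_greatest) (auto simp: I_def[symmetric] field_simps)
  then have "K \<le> (K - I ^ (m - 1)) * I"
    using w by (simp add: field_simps)
  moreover have "I ^ (m - 1) * I = I ^ m"
    using assms(1) by (simp flip: power_Suc2)
  ultimately have "I ^ m - K * I + K \<le> 0"
    by (simp add: algebra_simps)
  moreover have "I < real m / (real m - 1)"
  proof -
    have "r 0 < real m / (real m - 1)"
      using contra pos[of 0] by (simp add: r_def pos_divide_less_eq)
    with I_le[of 0] show ?thesis by simp
  qed
  ultimately show False
    using star_polynomial_pos[OF assms(1), of I] I1 unfolding K_def by linarith
qed

section \<open>Lower bound for an arbitrary strategy\<close>

lemma search_strategy_le_same_ray:
  assumes "search_strategy m x" "1 \<le> j" "j < k + m" "j mod m = k mod m"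
  shows "x j \<le> (if k = 0 then 0 else x k)"
proof (cases "j \<le> k")
  case True
  then obtain a where a: "k = j + a * m"
    using assms(4) by (metis le_add_diff_inverse mod_eq_dvd_iff_nat dvd_def mult.commute)
  have "x j \<le> x (j + a * m)"
  proof (induction a)
    case (Suc a)
    have "x (j + a * m) < x (j + a * m + m)"
      using assms(1,2) unfolding search_strategy_def by auto
    with Suc show ?case by (simp add: algebra_simps)
  qed simp
  with a assms(2) show ?thesis by simp
next
  \<comment> \<open>A positive multiple of \<open>m\<close> below \<open>m\<close> is impossible.
    Every \<open>j\<close> with \<open>k = 0\<close> falls here: ray 0 is not visited before step
    \<open>m\<close>.\<close>
  case False
  then have "m dvd j - k"
    using assms(4) by (metis mod_eq_dvd_iff_nat nat_le_linear)
  with False assms(3) show ?thesis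
    by (auto dest!: dvd_imp_le)
qed

lemma search_cost_ge:
  assumes "search_strategy m x" "d \<ge> 0" "1 \<le> n"
    and late: "\<And>j. finds_at m x r t j \<Longrightarrow> n \<le> j"
  shows "ereal (2 * (\<Sum>i=1..<n. x i) + (real n - 1) * d + t) \<le> search_cost m d x r t"
proof (cases "\<exists>k. finds_at m x r t k")
  case True
  define L where "L = (LEAST k. finds_at m x r t k)"
  have L: "n \<le> L"
    unfolding L_def using late LeastI_ex[OF True] .
  have "(\<Sum>i=1..<n. x i) \<le> (\<Sum>i=1..<L. x i)"
    using L assms(1) by (intro sum_mono2) (auto simp: search_strategy_def less_imp_le)
  moreover have "(real n - 1) * d \<le> (real L - 1) * d"
    using L assms(2) by (intro mult_right_mono) auto
  ultimately show ?thesis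
    using True by (simp add: search_cost_def L_def[symmetric])
qed (simp add: search_cost_def)

lemma finds_all_within_partial_sum_le:
  assumes "search_strategy m x" "m \<ge> 2" "d \<ge> 0" "K > 0"
    and fin: "finds_all_within m d x (1 + 2 * K) B"
  shows "2 * (\<Sum>i=1..<k+m. x i) + (real (k + m) - 1) * d
           \<le> 2 * K * (if k = 0 then 0 else x k) + B"
proof (rule field_le_epsilon)
  fix e :: real assume "e > 0"
  define s where "s = (if k = 0 then 0 else x k)"
  \<comment> \<open>The offset is scaled so that the slope \<open>2 * K\<close>, left after
    cancelling \<open>t\<close> on both sides, turns it into exactly \<open>e\<close>.\<close>
  define t where "t = s + e / (2 * K)"
  have "s \<ge> 0"
    using assms(1) by (auto simp: s_def search_strategy_def less_imp_le)
  then have t: "t > s" "t > 0"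
    using \<open>e > 0\<close> \<open>K > 0\<close> by (auto simp: t_def add_nonneg_pos)
  have "k + m \<le> j" if "finds_at m x (k mod m) t j" for j
    using search_strategy_le_same_ray[OF assms(1), of j k] that t
    by (force simp: finds_at_def s_def)
  then have "ereal (2 * (\<Sum>i=1..<k+m. x i) + (real (k + m) - 1) * d + t)
      \<le> search_cost m d x (k mod m) t"
    using assms by (intro search_cost_ge) auto
  also have "\<dots> \<le> ereal ((1 + 2 * K) * t + B)"
    using fin assms(2) t by (simp add: finds_all_within_def)
  finally have "2 * (\<Sum>i=1..<k+m. x i) + (real (k + m) - 1) * d \<le> 2 * K * t + B"
    by (simp add: algebra_simps)
  also have "2 * K * t = 2 * K * s + e"
    using \<open>K > 0\<close> by (simp add: t_def field_simps)
  finally show "2 * (\<Sum>i=1..<k+m. x i) + (real (k + m) - 1) * d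
      \<le> 2 * K * (if k = 0 then 0 else x k) + B + e"
    by (simp add: s_def)
qed

lemma additive_constant_ge:
  fixes d B :: real
  assumes "m \<ge> 2" "d > 0" and strat: "search_strategy m x"
  defines "K \<equiv> real m ^ m / (real m - 1) ^ (m - 1)"
  assumes fin: "finds_all_within m d x (1 + 2 * K) B"
  shows "(K - real m) * d \<le> B"
proof (rule ccontr)
  assume contra: "\<not> ?thesis"
  \<comment> \<open>With this \<open>e\<close>, all additive constants in the recurrence for
    \<open>T\<close> combine to \<open>K * d / 2\<close>, which is the turn cost share inside
    \<open>K * y k\<close>.\<close>
  define e where "e = ((K - real m) * d - B) / 2"
  have e: "e > 0" using contra by (simp add: e_def)
  \<comment> \<open>Each step absorbs half a turn cost; index 0 stands for the origin, at distance
    0.\<close>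
  define y where "y i = (if i = 0 then 0 else x i) + d / 2" for i
  define T where "T k = (real m - 1) * d / 2 + e + (\<Sum>i<k. y i)" for k
  have K_pos: "K > 0"
    unfolding K_def using assms(1) by simp
  have y_pos: "y i > 0" for i
    using strat \<open>d > 0\<close> by (auto simp: y_def search_strategy_def intro!: add_pos_pos)
  have "(real m - 1) * d / 2 + e > 0"
    using assms(1,2) e by (intro add_nonneg_pos) auto
  then have T_pos: "T k > 0" for k
    unfolding T_def by (rule add_pos_nonneg) (simp add: sum_nonneg less_imp_le y_pos)
  have T_Suc: "T (Suc k) - T k = y k" for k
    by (simp add: T_def)
  have T_mono: "T k \<le> T (Suc k)" for k
    using T_Suc[of k] y_pos[of k] by linarith
  have sum_y: "(\<Sum>i<n. y i) = (\<Sum>i=1..<n. x i) + real n * d / 2" for n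
  proof (induction n)
    case (Suc n)
    then show ?case
      by (cases "n = 0") (auto simp: y_def field_simps)
  qed simp
  have "T (k + m) \<le> K * (T (Suc k) - T k)" for k
  proof -
    have "2 * (\<Sum>i=1..<k+m. x i) + (real (k + m) - 1) * d
        \<le> 2 * K * (if k = 0 then 0 else x k) + B"
      using finds_all_within_partial_sum_le[OF strat assms(1) _ K_pos fin] \<open>d > 0\<close> by simp
    then show ?thesis
      unfolding T_Suc T_def sum_y by (simp add: y_def e_def field_simps split: if_splits)
  qed
  then have "real m / (real m - 1) * T 0 \<le> T 1"
    using assms(1) T_pos T_mono unfolding K_def by (intro ratio_ge_of_recurrence)
  then have "real m * T 0 \<le> (real m - 1) * T 1"
    using assms(1) by (simp add: field_simps)
  \<comment> \<open>As \<open>T 0 = (real m - 1) * d / 2 + e\<close> and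
    \<open>T 1 = real m * d / 2 + e\<close>, the terms in \<open>d\<close> cancel.\<close>
  then have "e \<le> 0"
    by (simp add: T_def y_def field_simps)
  with e show False by simp
qed

section \<open>Upper bound for the geometric strategy\<close>

lemma geometric_strategy_partial_sum:
  fixes d :: real
  assumes "m \<ge> 2" "n \<ge> 1"
  defines "q \<equiv> real m / (real m - 1)"
  shows "2 * (\<Sum>i=1..<n. d / 2 * (q ^ i - 1)) + (real n - 1) * d
           = d * ((real m - 1) * q ^ n - real m)"
  using assms(2)
proof (induction n rule: dec_induct)
  case base
  then show ?case using assms(1) by (simp add: q_def)
next
  case (step n)
  \<comment> \<open>The summand -1 in the strategy offsets the turn cost: step \<open>n\<close>
    costs \<open>d * q ^ n\<close> in total, a purely geometric term.\<close>
  have "(real m - 1) * q ^ Suc n = real m * q ^ n"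
    using assms(1) by (simp add: q_def)
  then have "d * ((real m - 1) * q ^ Suc n - real m) = d * ((real m - 1) * q ^ n - real m) + d * q ^ n"
    by (simp add: algebra_simps)
  moreover have "(\<Sum>i=1..<Suc n. d / 2 * (q ^ i - 1)) = (\<Sum>i=1..<n. d / 2 * (q ^ i - 1)) + d / 2 * (q ^ n - 1)"
    using step by simp
  ultimately show ?case
    using step.IH by (simp add: field_simps)
qed

lemma geometric_strategy_finds_all_within:
  fixes d :: real
  assumes "m \<ge> 2" "d > 0"
  defines "K \<equiv> real m ^ m / (real m - 1) ^ (m - 1)"
    and "x \<equiv> (\<lambda>i::nat. d / 2 * ((real m / (real m - 1)) ^ i - 1))"
  shows "finds_all_within m d x (1 + 2 * K) ((K - real m) * d)"
  unfolding finds_all_within_def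
proof (intro allI impI)
  fix r t assume "r < m" and t: "(0::real) < t"
  define q where "q = real m / (real m - 1)"
  have q: "q > 1"
    using assms(1) by (simp add: q_def field_simps)
  have x_eq: "x = (\<lambda>i. d / 2 * (q ^ i - 1))"
    by (simp add: x_def q_def)
  have Kq: "K = (real m - 1) * q ^ m"
    unfolding K_def q_def using star_constant_eq(1)[OF assms(1)] .
  have ex: "\<exists>k. finds_at m x r t k"
  proof -
    obtain n where "2 * t / d + 1 < q ^ n"
      using real_arch_pow[OF q] by blast
    \<comment> \<open>The index is moved up to ray \<open>r\<close>; \<open>Suc n\<close> keeps it
      positive even for \<open>r = 0\<close>.\<close>
    also have "n \<le> r + Suc n * m"
      using assms(1) by (simp add: trans_le_add2)
    then have "q ^ n \<le> q ^ (r + Suc n * m)"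
      using q by (intro power_increasing) auto
    finally have "t \<le> x (r + Suc n * m)"
      using assms(2) by (simp add: x_eq field_simps)
    moreover have "1 \<le> r + Suc n * m"
      using assms(1) by simp
    moreover have "(r + Suc n * m) mod m = r"
      using \<open>r < m\<close> by (simp del: mult_Suc)
    ultimately have "finds_at m x r t (r + Suc n * m)"
      by (simp add: finds_at_def del: mult_Suc)
    then show ?thesis ..
  qed
  define k where "k = (LEAST k. finds_at m x r t k)"
  have k: "k \<ge> 1" "k mod m = r"
    using LeastI_ex[OF ex] by (auto simp: k_def finds_at_def)
  have x_less: "x (k - m) < t"
  proof (cases "k \<le> m")
    \<comment> \<open>Truncated subtraction gives \<open>k - m = 0\<close>, and the formula yields
      \<open>x 0 = 0\<close>, so a first visit to the ray needs no separate estimate.\<close>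
    case True
    then show ?thesis using t by (simp add: x_def)
  next
    case False
    then have "\<not> finds_at m x r t (k - m)"
      using assms(1) by (intro not_less_Least) (auto simp: k_def[symmetric])
    with False k show ?thesis by (auto simp: finds_at_def le_mod_geq)
  qed
  \<comment> \<open>Only an inequality, because of truncation when \<open>k < m\<close>.\<close>
  have "q ^ k \<le> q ^ (m + (k - m))"
    using q by (intro power_increasing) auto
  then have "(real m - 1) * q ^ k \<le> K * q ^ (k - m)"
    using assms(1) unfolding Kq mult.assoc power_add by (intro mult_left_mono) auto
  then have "d * ((real m - 1) * q ^ k - real m) \<le> d * (K * q ^ (k - m) - real m)"
    using assms(2) by simp
  also have "\<dots> = 2 * K * x (k - m) + (K - real m) * d"
    by (simp add: x_eq field_simps)
  also have "\<dots> \<le> 2 * K * t + (K - real m) * d"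
    using x_less assms(1) by (intro add_right_mono mult_left_mono) (auto simp: K_def)
  finally have "2 * (\<Sum>i=1..<k. x i) + (real k - 1) * d \<le> 2 * K * t + (K - real m) * d"
    using geometric_strategy_partial_sum[OF assms(1) k(1)] by (simp add: x_def q_def)
  then show "search_cost m d x r t \<le> ereal ((1 + 2 * K) * t + (K - real m) * d)"
    using ex by (simp add: search_cost_def k_def[symmetric] algebra_simps)
qed

theorem theorem7:
  fixes m :: nat and d :: real
  assumes "m \<ge> 2" and "d > 0"
  defines "c \<equiv> 1 + 2 * (real m ^ m / (real m - 1) ^ (m - 1))"
    and "A \<equiv> real m * ((real m / (real m - 1)) ^ (m - 1) - 1) * d"
    and "xs \<equiv> (\<lambda>i::nat. d / 2 * ((real m / (real m - 1)) ^ i - 1))"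
  shows "(search_strategy m xs \<and> finds_all_within m d xs c A) \<and>
    (\<forall>(B::real) (x::nat \<Rightarrow> real).
       search_strategy m x \<and> finds_all_within m d x c B \<longrightarrow> B \<ge> A)"
proof -
  have A_eq: "A = (real m ^ m / (real m - 1) ^ (m - 1) - real m) * d"
    unfolding A_def star_constant_eq(2)[OF assms(1)] by (simp add: algebra_simps)
  have q: "real m / (real m - 1) > 1"
    using assms(1) by (simp add: field_simps)
  have "search_strategy m xs"
    unfolding search_strategy_def xs_def
    using assms(1,2) q by (auto intro!: one_less_power power_strict_increasing)
  then show ?thesis
    using geometric_strategy_finds_all_within[OF assms(1,2)]
      additive_constant_ge[OF assms(1,2)]
    unfolding A_eq c_def xs_def by blast
qed

end
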